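(* Let $r>1$, and set $\beta_r(n)=\frac12r^{-n}$ for $n\in\mathbb{N}$. Then, for any $x,y\in\mathcal{C}=\prod_{n\in\mathbb{N}}\mathbb{Z}_2$ (points being identified with evaluation states on $C(\mathcal{C})$): $$\mathsf{mk}_{L_{\mathcal{T},\lambda}^{\beta_r}}(x,y)=\begin{cases}0&\text{if }x=y,\\ r^{-\min\{n\in\mathbb{N}:x_n\neq y_n\}}&\text{otherwise.}\end{cases}$$
   Context: $\mathbb{N}=\{0,1,2,\ldots\}$; $\mathbb{Z}_2=\{0,1\}$ is discrete and $\mathcal{C}=\prod_{n\in\mathbb{N}}\mathbb{Z}_2$ has the product topology. $C(\mathcal{C})$ is the C*-algebra of continuous $\mathbb{C}$-valued functions on $\mathcal{C}$. Let $\eta_n\in C(\mathcal{C})$, $\eta_n((z_m)_m)=z_n$, and $u_n=2\eta_n-1_{C(\mathcal{C})}$. Let $A_0=\mathbb{C}1_{C(\mathcal{C})}$ and, for $n\geq1$, let $A_n$ be the C*-subalgebra of $C(\mathcal{C})$ generated by $1_{C(\mathcal{C})},u_0,\ldots,u_{n-1}$. With inclusion maps, $\mathcal{T}=(A_n)_{n\in\mathbb{N}}$ is an inductive sequence of finite dimensional algebras with limit $C(\mathcal{C})$. $\lambda$ is the faithful tracial state on $C(\mathcal{C})$ given by integration against the Haar probability measure of the compact group $\mathcal{C}$ (pointwise addition modulo $2$). Let $E_n$ be the unique conditional expectation of $C(\mathcal{C})$ onto $A_n$ with $\lambda\circ E_n=\lambda$. For $\beta:\mathbb{N}\to(0,\infty)$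 with limit $0$ and self-adjoint $f\in C(\mathcal{C})$ set $$L_{\mathcal{T},\lambda}^\beta(f)=\sup_{n\in\mathbb{N}}\frac{\|f-E_n(f)\|_{C(\mathcal{C})}}{\beta(n)}.$$ For states $\varphi,\psi$ of $C(\mathcal{C})$, the Monge-Kantorovich metric is $\mathsf{mk}_L(\varphi,\psi)=\sup\{|\varphi(f)-\psi(f)|:f=f^*\in C(\mathcal{C}),\ L(f)\leq1\}$. *)

theory Defs
  imports "HOL-Probability.Probability" "HOL-Library.Z2"
begin

section \<open>The Cantor group\<close>

instantiation bit :: discrete_topology
begin

definition open_bit :: "bit set \<Rightarrow> bool"
  where "open_bit S \<longleftrightarrow> True"

instance
  by standard (simp_all add: open_bit_def)

end

text \<open>The topology on the function type is the product topology.\<close>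

type_synonym cantor = "nat \<Rightarrow> bit"

text \<open>
  The Haar probability measure is the translation-invariant Borel probability measure. No
  regularity condition is imposed: the space is compact and second countable, so every finite
  Borel measure on it is regular.
\<close>

definition haar_prob :: "cantor measure \<Rightarrow> bool"
  where "haar_prob \<mu> \<longleftrightarrow>
    sets \<mu> = sets borel \<and> prob_space \<mu> \<and>
    (\<forall>z. distr \<mu> borel (\<lambda>x n. z n + x n) = \<mu>)"

definition haar :: "cantor measure"
  where "haar = (THE \<mu>. haar_prob \<mu>)"


section \<open>Bounded continuous functions as a unital algebra with involution\<close>

instantiation bcontfun :: (topological_space, real_normed_algebra_1) real_normed_algebra_1
begin

definition one_bcontfun :: "'a \<Rightarrow>\<^sub>C 'b"
  where "one_bcontfun = const_bcontfun 1"

definition times_bcontfun :: "('a \<Rightarrow>\<^sub>C 'b) \<Rightarrow> ('a \<Rightarrow>\<^sub>C 'b) \<Rightarrow> 'a \<Rightarrow>\<^sub>C 'b"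
  where "times_bcontfun f g = Bcontfun (\<lambda>x. f x * g x)"

lemma apply_times_bcontfun [simp]: "apply_bcontfun (f * g) x = f x * g x"
  for f g :: "'a \<Rightarrow>\<^sub>C 'b"
proof -
  have "(\<lambda>x. f x * g x) \<in> bcontfun"
  proof (rule bcontfun_normI)
    show "continuous_on UNIV (\<lambda>x. f x * g x)"
      by (intro continuous_intros) auto
    show "norm (f x * g x) \<le> norm f * norm g" for x
      by (rule order_trans[OF norm_mult_ineq]) (intro mult_mono norm_bounded norm_ge_zero)
  qed
  then show ?thesis
    by (simp add: times_bcontfun_def Bcontfun_inverse)
qed

lemma apply_one_bcontfun [simp]: "apply_bcontfun (1 :: 'a \<Rightarrow>\<^sub>C 'b) x = 1"
  by (simp add: one_bcontfun_def)

instance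
proof
  fix a b c :: "'a \<Rightarrow>\<^sub>C 'b" and r :: real
  show "a * b * c = a * (b * c)" "1 * a = a" "a * 1 = a"
    by (rule bcontfun_eqI; simp add: mult.assoc)+
  show "(a + b) * c = a * c + b * c" "a * (b + c) = a * b + a * c"
    by (rule bcontfun_eqI; simp add: algebra_simps)+
  show "r *\<^sub>R a * b = r *\<^sub>R (a * b)" "a * r *\<^sub>R b = r *\<^sub>R (a * b)"
    by (rule bcontfun_eqI; simp)+
  have "apply_bcontfun (0 :: 'a \<Rightarrow>\<^sub>C 'b) undefined \<noteq> apply_bcontfun 1 undefined"
    by simp
  then show "(0 :: 'a \<Rightarrow>\<^sub>C 'b) \<noteq> 1"
    by metis
  show "norm (a * b) \<le> norm a * norm b"
  proof (rule norm_bound)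
    show "norm ((a * b) x) \<le> norm a * norm b" for x
      unfolding apply_times_bcontfun
      by (rule order_trans[OF norm_mult_ineq]) (intro mult_mono norm_bounded norm_ge_zero)
  qed
  show "norm (1 :: 'a \<Rightarrow>\<^sub>C 'b) = 1"
  proof (rule antisym)
    show "norm (1 :: 'a \<Rightarrow>\<^sub>C 'b) \<le> 1"
      by (rule norm_bound) simp
    show "1 \<le> norm (1 :: 'a \<Rightarrow>\<^sub>C 'b)"
      using norm_bounded[of "1 :: 'a \<Rightarrow>\<^sub>C 'b" undefined] by simp
  qed
qed

end

instance bcontfun :: (topological_space, real_normed_field) comm_ring_1
  by standard (auto intro!: bcontfun_eqI simp: algebra_simps)

definition cscale :: "complex \<Rightarrow> ('a::topological_space \<Rightarrow>\<^sub>C complex) \<Rightarrow> 'a \<Rightarrow>\<^sub>C complex"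
  where "cscale c f = const_bcontfun c * f"

definition star :: "('a::topological_space \<Rightarrow>\<^sub>C complex) \<Rightarrow> 'a \<Rightarrow>\<^sub>C complex"
  where "star f = Bcontfun (\<lambda>x. cnj (f x))"

lemma apply_cscale [simp]: "apply_bcontfun (cscale c f) x = c * f x"
  by (simp add: cscale_def)

lemma apply_star [simp]: "apply_bcontfun (star f) x = cnj (f x)"
proof -
  have "(\<lambda>x. cnj (f x)) \<in> bcontfun"
    by (rule bcontfun_normI[where b = "norm f"])
      (auto intro!: continuous_intros simp: norm_bounded)
  then show ?thesis
    by (simp add: star_def Bcontfun_inverse)
qed

definition self_adjoint :: "('a::topological_space \<Rightarrow>\<^sub>C complex) \<Rightarrow> bool"
  where "self_adjoint f \<longleftrightarrow> star f = f"

definition positive_elt :: "('a::topological_space \<Rightarrow>\<^sub>C complex) \<Rightarrow> bool"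
  where "positive_elt f \<longleftrightarrow> (\<exists>g. f = star g * g)"

definition cstar_subalgebra :: "('a::topological_space \<Rightarrow>\<^sub>C complex) set \<Rightarrow> bool"
  where "cstar_subalgebra B \<longleftrightarrow>
    0 \<in> B \<and>
    (\<forall>f\<in>B. \<forall>g\<in>B. f + g \<in> B \<and> f * g \<in> B) \<and>
    (\<forall>c. \<forall>f\<in>B. cscale c f \<in> B) \<and>
    (\<forall>f\<in>B. star f \<in> B) \<and>
    closed B"

definition cstar_generated ::
    "('a::topological_space \<Rightarrow>\<^sub>C complex) set \<Rightarrow> ('a \<Rightarrow>\<^sub>C complex) set"
  where "cstar_generated S = \<Inter>{B. cstar_subalgebra B \<and> S \<subseteq> B}"

text \<open>
  A conditional expectation onto a C*-subalgebra \<open>B\<close>: a linear, positive, contractive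
  \<open>B\<close>-bimodule projection with range \<open>B\<close>.
\<close>

definition cond_expectation ::
    "('a::topological_space \<Rightarrow>\<^sub>C complex) set
      \<Rightarrow> (('a \<Rightarrow>\<^sub>C complex) \<Rightarrow> ('a \<Rightarrow>\<^sub>C complex)) \<Rightarrow> bool"
  where "cond_expectation B E \<longleftrightarrow>
    (\<forall>f g. E (f + g) = E f + E g) \<and>
    (\<forall>c f. E (cscale c f) = cscale c (E f)) \<and>
    (\<forall>f. positive_elt f \<longrightarrow> positive_elt (E f)) \<and>
    (\<forall>f. norm (E f) \<le> norm f) \<and>
    (\<forall>a\<in>B. \<forall>b\<in>B. \<forall>f. E (a * f * b) = a * E f * b) \<and>
    range E = B \<and>
    (\<forall>b\<in>B. E b = b)"


section \<open>The inductive sequence in $C(\mathcal{C})$ and its Lip-norm\<close>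

text \<open>As \<open>cantor\<close> is compact, \<open>cantor \<Rightarrow>\<^sub>C complex\<close> is all of $C(\mathcal{C})$.\<close>

definition eta :: "nat \<Rightarrow> cantor \<Rightarrow>\<^sub>C complex"
  where "eta n = Bcontfun (\<lambda>z. of_bool (z n = 1))"

lemma apply_eta [simp]: "apply_bcontfun (eta n) z = of_bool (z n = 1)"
proof -
  have "continuous_on UNIV (\<lambda>z::cantor. z n)"
    by (rule continuous_on_product_coordinates)
  from continuous_on_compose[OF this, of "\<lambda>b. of_bool (b = 1) :: complex"]
  have "continuous_on UNIV ((\<lambda>b::bit. of_bool (b = 1) :: complex) \<circ> (\<lambda>z::cantor. z n))"
    by (simp add: continuous_on_open_vimage open_discrete Int_absorb2)
  then have "(\<lambda>z::cantor. of_bool (z n = 1) :: complex) \<in> bcontfun"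
    by (intro bcontfun_normI[where b = 1]) (auto simp: o_def)
  then show ?thesis
    by (simp add: eta_def Bcontfun_inverse)
qed

definition u_gen :: "nat \<Rightarrow> cantor \<Rightarrow>\<^sub>C complex"
  where "u_gen n = 2 * eta n - 1"

definition A_alg :: "nat \<Rightarrow> (cantor \<Rightarrow>\<^sub>C complex) set"
  where "A_alg n = (if n = 0 then range (\<lambda>c. cscale c 1)
                else cstar_generated (insert 1 (u_gen ` {..<n})))"

definition haar_state :: "(cantor \<Rightarrow>\<^sub>C complex) \<Rightarrow> complex"
  where "haar_state f = (LINT x|haar. f x)"

definition E_exp :: "nat \<Rightarrow> (cantor \<Rightarrow>\<^sub>C complex) \<Rightarrow> (cantor \<Rightarrow>\<^sub>C complex)"
  where "E_exp n = (THE F. cond_expectation (A_alg n) F \<and> haar_state \<circ> F = haar_state)"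

text \<open>The suprema are taken in $[0,\infty]$.\<close>

definition lip_norm :: "(nat \<Rightarrow> real) \<Rightarrow> (cantor \<Rightarrow>\<^sub>C complex) \<Rightarrow> ennreal"
  where "lip_norm \<beta> f = (SUP n. ennreal (norm (f - E_exp n f) / \<beta> n))"

definition mk ::
    "(('a::topological_space \<Rightarrow>\<^sub>C complex) \<Rightarrow> ennreal)
      \<Rightarrow> (('a \<Rightarrow>\<^sub>C complex) \<Rightarrow> complex) \<Rightarrow> (('a \<Rightarrow>\<^sub>C complex) \<Rightarrow> complex) \<Rightarrow> ennreal"
  where "mk L \<phi> \<psi> = (SUP f\<in>{f. self_adjoint f \<and> L f \<le> 1}. ennreal (cmod (\<phi> f - \<psi> f)))"

definition eval_state :: "'a::topological_space \<Rightarrow> ('a \<Rightarrow>\<^sub>C complex) \<Rightarrow> complex"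
  where "eval_state x f = f x"

definition beta_geom :: "real \<Rightarrow> nat \<Rightarrow> real"
  where "beta_geom r n = 1 / 2 * r powr (- real n)"

end

theory Submission
  imports Defs
begin

text \<open>
  The conditional expectation \<open>E\<^sub>n\<close> averages over the coordinates from \<open>n\<close> onwards:
  \<open>(E\<^sub>n f)(x)\<close> is the Haar integral over \<open>z\<close> of \<open>f (x + t\<^sub>n z)\<close>, where the endomorphism
  \<open>t\<^sub>n\<close> of the group sets the first \<open>n\<close> coordinates to zero. Once this is known, the distance is
  a short computation. Let \<open>N\<close> be the first index at which \<open>x\<close> and \<open>y\<close> differ. The function
  \<open>E\<^sub>N f\<close> takes the same value at \<open>x\<close> and \<open>y\<close>, so
  \<open>\<bar>f x - f y\<bar> \<le> 2 \<parallel>f - E\<^sub>N f\<parallel> \<le> 2 \<beta>(N) = r\<^sup>-\<^sup>N\<close> whenever \<open>f\<close> has Lip-norm at most 1.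
  Equality holds for \<open>f = \<beta>(N) u\<^sub>N\<close>: flipping coordinate \<open>N\<close> changes the sign of \<open>u\<^sub>N\<close>,
  so \<open>E\<^sub>n u\<^sub>N = 0\<close> for \<open>n \<le> N\<close>, while \<open>E\<^sub>n u\<^sub>N = u\<^sub>N\<close> for \<open>n > N\<close>. As \<open>\<beta>\<close> decreases,
  \<open>f\<close> has Lip-norm at most 1, and its values at \<open>x\<close> and \<open>y\<close> are \<open>\<beta>(N)\<close> and \<open>-\<beta>(N)\<close>
  in some order.

  The remaining work identifies the objects given by a uniqueness property.
  The Haar measure is the law of a sequence of fair coin flips; two invariant probability measures
  agree because Fubini's theorem evaluates the integral of the indicator of \<open>x + z\<close> in two ways
  (\<open>haar_prob_exists\<close>, \<open>haar_prob_unique\<close>). The algebra \<open>A\<^sub>n\<close> consists of the functions of the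
  first \<open>n\<close> coordinates (\<open>A_alg_eq\<close>). Translation invariance and Fubini's theorem
  make the average over the tail a conditional expectation that preserves the trace. For any other
  such \<open>F\<close>, the difference \<open>F f - E\<^sub>n f\<close> lies in \<open>A\<^sub>n\<close> and is orthogonal to it,
  and the trace is faithful on \<open>A\<^sub>n\<close> because cylinders have positive measure (\<open>E_exp_eq\<close>).
\<close>

section \<open>Topology of the Cantor group\<close>

text \<open>
  Addition of bits is used as a group operation and not as a Boolean one, and continuity of group-valued maps is
  reduced to \<open>\<boxplus>\<close> and \<open>tail\<close> instead of being checked coordinate by coordinate.
\<close>

declare add_bit_eq_xor [simp del]
declare continuous_on_coordinatewise_then_product [continuous_intros del]

lemma finite_UNIV_bit: "finite (UNIV :: bit set)"
proof (rule finite_subset)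
  show "(UNIV :: bit set) \<subseteq> {0, 1}"
    using bit_not_zero_iff by blast
qed simp

text \<open>
  Second countability makes the Borel sets of the Cantor group and of its square agree with the product
  \<open>\<sigma>\<close>-algebras, which is what coin flips and Fubini's theorem work with.
\<close>

instance bit :: second_countable_topology
proof
  have "open = generate_topology (UNIV :: bit set set)"
    by (intro ext) (simp add: open_bit_def generate_topology.Basis)
  moreover have "countable (UNIV :: bit set set)"
    by (rule countable_finite) (simp only: Finite_Set.finite_set finite_UNIV_bit)
  ultimately show "\<exists>B :: bit set set. countable B \<and> open = generate_topology B"
    by blast
qed

lemma nhds_bit: "nhds (a :: bit) = principal {a}"
  by (rule discrete_topology_class.nhds_discrete)

lemma tendsto_add_bit: "LIM x (nhds a \<times>\<^sub>F nhds b). fst x + snd x :> nhds (a + b)" for a b :: bit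
  unfolding nhds_bit principal_prod_principal
  by (rule filterlim_principal[THEN iffD2]) (simp add: eventually_principal)

instance bit :: topological_monoid_add
  by standard (rule tendsto_add_bit)

lemma bit_add_add_self: "a + (a + b) = (b :: bit)"
  by (cases a; cases b) simp_all

definition cadd :: "cantor \<Rightarrow> cantor \<Rightarrow> cantor"  (infixl "\<boxplus>" 65)
  where "z \<boxplus> x = (\<lambda>n. z n + x n)"

definition tail :: "nat \<Rightarrow> cantor \<Rightarrow> cantor"
  where "tail n z = (\<lambda>i. if i < n then 0 else z i)"

lemma cadd_commute: "x \<boxplus> y = y \<boxplus> x"
  by (rule ext) (simp only: cadd_def add.commute)

lemma cadd_assoc: "x \<boxplus> y \<boxplus> z = x \<boxplus> (y \<boxplus> z)"
  by (simp only: cadd_def add.assoc)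

lemma tail_cadd: "tail n (x \<boxplus> y) = tail n x \<boxplus> tail n y"
  by (rule ext) (simp add: tail_def cadd_def)

lemma continuous_on_cantor_coordinate:
  assumes "continuous_on S f"
  shows "continuous_on S (\<lambda>x. (f x :: cantor) i)"
  using continuous_on_compose2[OF continuous_on_product_coordinates[of i] assms] by simp

lemma continuous_on_cadd [continuous_intros]:
  assumes "continuous_on S f" "continuous_on S g"
  shows "continuous_on S (\<lambda>x. f x \<boxplus> g x)"
  unfolding cadd_def
  by (rule continuous_on_coordinatewise_then_product, rule continuous_on_add)
    (rule continuous_on_cantor_coordinate assms)+

lemma continuous_on_tail [continuous_intros]:
  assumes "continuous_on S f"
  shows "continuous_on S (\<lambda>x. tail n (f x))"
proof -
  have "continuous_on S (\<lambda>x. if i < n then 0 else f x i)" for i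
    using continuous_on_cantor_coordinate[OF assms, of i] by (cases "i < n") simp_all
  then show ?thesis
    unfolding tail_def by (rule continuous_on_coordinatewise_then_product)
qed

lemma continuous_on_bcontfun [continuous_intros]:
  assumes "continuous_on S g"
  shows "continuous_on S (\<lambda>x. apply_bcontfun f (g x))"
  using continuous_on_compose2[OF continuous_on_apply_bcontfun[of UNIV f] assms] by simp

definition depends_on_first :: "nat \<Rightarrow> (cantor \<Rightarrow> 'b) \<Rightarrow> bool"
  where "depends_on_first n h \<longleftrightarrow> (\<forall>x y. (\<forall>i<n. x i = y i) \<longrightarrow> h x = h y)"

lemma depends_on_firstD: "depends_on_first n h \<Longrightarrow> (\<And>i. i < n \<Longrightarrow> x i = y i) \<Longrightarrow> h x = h y"
  unfolding depends_on_first_def by blast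

lemma depends_on_firstI:
  "(\<And>x y. (\<And>i. i < n \<Longrightarrow> x i = y i) \<Longrightarrow> h x = h y) \<Longrightarrow> depends_on_first n h"
  unfolding depends_on_first_def by blast

lemma depends_on_first_tail:
  assumes "depends_on_first n h"
  shows "h (x \<boxplus> tail n z) = h x"
  by (rule depends_on_firstD[OF assms]) (simp add: cadd_def tail_def)

lemma depends_on_first_map2:
  assumes "depends_on_first n f" "depends_on_first n g" and k: "\<And>x. k x = F (f x) (g x)"
  shows "depends_on_first n k"
proof (rule depends_on_firstI)
  fix x y :: cantor assume "\<And>i. i < n \<Longrightarrow> x i = y i"
  then have "f x = f y" "g x = g y"
    using depends_on_firstD[OF assms(1)] depends_on_firstD[OF assms(2)] by blast+
  then show "k x = k y"
    by (simp add: k)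
qed

lemma depends_on_first_zero: "depends_on_first 0 h \<longleftrightarrow> (\<exists>c. h = (\<lambda>_. c))"
proof
  assume h: "depends_on_first 0 h"
  have "h = (\<lambda>_. h undefined)"
    by (rule ext, rule depends_on_firstD[OF h]) simp
  then show "\<exists>c. h = (\<lambda>_. c)" ..
qed (auto intro: depends_on_firstI)

lemma open_agree: "open {y :: cantor. \<forall>i<n. y i = x i}"
proof -
  have "open ((\<lambda>y :: cantor. y i) -` {x i})" for i
    using continuous_on_product_coordinates[of i]
    by (intro open_vimage) (simp_all add: open_bit_def)
  then have "open (\<Inter>i\<in>{..<n}. (\<lambda>y :: cantor. y i) -` {x i})"
    by blast
  also have "(\<Inter>i\<in>{..<n}. (\<lambda>y :: cantor. y i) -` {x i}) = {y. \<forall>i<n. y i = x i}"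
    by auto
  finally show ?thesis .
qed

text \<open>
  A function of finitely many coordinates is constant on each member of an open partition, so its codomain may carry any
  topology.
\<close>

lemma continuous_on_depends_on_first:
  fixes h :: "cantor \<Rightarrow> 'b::topological_space"
  assumes "depends_on_first n h"
  shows "continuous_on UNIV h"
proof -
  have "open (h -` B)" for B
  proof (rule topological_space_class.openI)
    fix x assume x: "x \<in> h -` B"
    have "{y. \<forall>i<n. y i = x i} \<subseteq> h -` B"
    proof
      fix y assume "y \<in> {y. \<forall>i<n. y i = x i}"
      then have "h y = h x"
        by (intro depends_on_firstD[OF assms, of y x]) simp
      then show "y \<in> h -` B"
        using x by simp
    qed
    then show "\<exists>T. open T \<and> x \<in> T \<and> T \<subseteq> h -` B"
      by (intro exI[of _ "{y. \<forall>i<n. y i = x i}"]) (simp add: open_agree)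
  qed
  then show ?thesis
    by (simp add: continuous_on_open_vimage)
qed

section \<open>Haar measure\<close>

lemma measurable_cadd [measurable]:
  "(\<lambda>p. fst p \<boxplus> snd p) \<in> borel \<Otimes>\<^sub>M borel \<rightarrow>\<^sub>M borel"
proof -
  have "(\<lambda>p. fst p \<boxplus> snd p) \<in> borel \<rightarrow>\<^sub>M borel"
    by (intro borel_measurable_continuous_onI continuous_intros)
  then show ?thesis
    by (simp only: borel_prod)
qed

lemma measurable_translate [measurable]: "(\<boxplus>) z \<in> borel \<rightarrow>\<^sub>M borel"
  by (intro borel_measurable_continuous_onI continuous_intros)

lemma haar_prob_iff:
  "haar_prob \<mu> \<longleftrightarrow>
    sets \<mu> = sets borel \<and> prob_space \<mu> \<and> (\<forall>z. distr \<mu> borel ((\<boxplus>) z) = \<mu>)"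
  by (simp add: haar_prob_def cadd_def [abs_def])

text \<open>
  Integrate the indicator of \<open>A\<close> at \<open>x + z\<close> over \<open>\<mu>\<close> in \<open>x\<close> and \<open>\<nu>\<close> in \<open>z\<close>. Invariance of \<open>\<mu>\<close>
  makes the inner integral over \<open>x\<close> equal to \<open>\<mu> A\<close> for each \<open>z\<close>; since the group is
  commutative, invariance of \<open>\<nu>\<close> makes the one over \<open>z\<close> equal to \<open>\<nu> A\<close>.
\<close>

lemma haar_prob_unique:
  assumes \<mu>: "haar_prob \<mu>" and \<nu>: "haar_prob \<nu>"
  shows "\<mu> = \<nu>"
proof (rule measure_eqI)
  note [measurable_cong] = conjunct1[OF \<mu>[unfolded haar_prob_iff]]
    conjunct1[OF \<nu>[unfolded haar_prob_iff]]
  interpret M: prob_space \<mu> using \<mu> by (simp add: haar_prob_iff)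
  interpret N: prob_space \<nu> using \<nu> by (simp add: haar_prob_iff)
  interpret P: pair_sigma_finite \<mu> \<nu> ..
  show "sets \<mu> = sets \<nu>"
    using \<mu> \<nu> by (simp add: haar_prob_iff)
  fix A assume "A \<in> sets \<mu>"
  then have A [measurable]: "A \<in> sets borel"
    using \<mu> by (simp add: haar_prob_iff)
  have *: "(\<integral>\<^sup>+x. indicator A (z \<boxplus> x) \<partial>\<kappa>) = emeasure \<kappa> A" if "haar_prob \<kappa>" for z \<kappa>
  proof -
    have [measurable_cong]: "sets \<kappa> = sets borel"
      using that by (simp add: haar_prob_iff)
    have "(\<integral>\<^sup>+x. indicator A (z \<boxplus> x) \<partial>\<kappa>) = (\<integral>\<^sup>+x. indicator A x \<partial>distr \<kappa> borel ((\<boxplus>) z))"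
      by (rule nn_integral_distr[symmetric]) measurable
    also have "\<dots> = emeasure \<kappa> A"
      using that by (simp add: haar_prob_iff)
    finally show ?thesis .
  qed
  have "emeasure \<mu> A = (\<integral>\<^sup>+z. (\<integral>\<^sup>+x. indicator A (x \<boxplus> z) \<partial>\<mu>) \<partial>\<nu>)"
    by (simp add: *[OF \<mu>] cadd_commute[of _ z for z] N.emeasure_space_1)
  also have "\<dots> = (\<integral>\<^sup>+x. (\<integral>\<^sup>+z. indicator A (x \<boxplus> z) \<partial>\<nu>) \<partial>\<mu>)"
    by (rule P.Fubini') measurable
  also have "\<dots> = emeasure \<nu> A"
    by (simp add: *[OF \<nu>] M.emeasure_space_1)
  finally show "emeasure \<mu> A = emeasure \<nu> A" .
qed

lemma sets_borel_bit: "sets (borel :: bit measure) = UNIV"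
  by (metis UNIV_eq_I borel_open open_bit_def)

text \<open>
  The infinite product of uniform measures on \<open>{0, 1}\<close> is invariant: translation by \<open>z\<close> acts on
  coordinate \<open>j\<close> as a permutation of \<open>{0, 1}\<close>, which the uniform measure does not notice.
\<close>

lemma haar_prob_exists: "\<exists>\<mu>. haar_prob \<mu>"
proof
  define coin :: "bit measure" where "coin = uniform_count_measure UNIV"
  have sets_coin: "sets coin = sets borel"
    by (simp add: coin_def sets_uniform_count_measure sets_borel_bit)
  have space_coin: "space coin = UNIV"
    by (simp add: coin_def space_uniform_count_measure)
  interpret coin: prob_space coin
    unfolding coin_def by (rule prob_space_uniform_count_measure) (simp_all add: finite_UNIV_bit)
  interpret P: product_prob_space "\<lambda>_ :: nat. coin" UNIV ..
  define \<mu> where "\<mu> = Pi\<^sub>M (UNIV :: nat set) (\<lambda>_. coin)"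
  have sets_\<mu> [measurable_cong]: "sets \<mu> = sets borel"
    unfolding \<mu>_def sets_PiM_equal_borel[symmetric] by (intro sets_PiM_cong refl sets_coin)
  have coin_inv: "emeasure coin ((+) b -` X) = emeasure coin X" for b X
  proof -
    have "card ((+) b -` X) = card X"
      by (rule card_vimage_inj) (metis bit_add_add_self injI, metis bit_add_add_self rangeI subsetI)
    then show ?thesis
      by (simp add: coin_def emeasure_uniform_count_measure finite_UNIV_bit)
  qed
  have "distr \<mu> borel ((\<boxplus>) z) = \<mu>" for z
    unfolding \<mu>_def
  proof (rule P.PiM_eq)
    show "sets (distr (Pi\<^sub>M UNIV (\<lambda>_. coin)) borel ((\<boxplus>) z)) = sets (Pi\<^sub>M UNIV (\<lambda>_. coin))"
      using sets_\<mu> by (simp add: \<mu>_def)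
    fix J :: "nat set" and F :: "nat \<Rightarrow> bit set"
    assume J: "finite J" and F: "\<And>j. j \<in> J \<Longrightarrow> F j \<in> sets coin"
    let ?X = "prod_emb UNIV (\<lambda>_. coin) J (Pi\<^sub>E J F)"
    have "?X \<in> sets \<mu>"
      unfolding \<mu>_def by (rule sets_PiM_I) (use J F in auto)
    then have X: "?X \<in> sets borel"
      by (simp only: sets_\<mu>)
    have "emeasure (distr \<mu> borel ((\<boxplus>) z)) ?X = emeasure \<mu> ((\<boxplus>) z -` ?X \<inter> space \<mu>)"
      by (rule emeasure_distr) (use X in measurable)
    also have "(\<boxplus>) z -` ?X \<inter> space \<mu> =
        prod_emb UNIV (\<lambda>_. coin) J (Pi\<^sub>E J (\<lambda>j. (+) (z j) -` F j))"
      by (auto simp: prod_emb_def \<mu>_def space_PiM space_coin PiE_iff cadd_def)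
    also have "emeasure \<mu> \<dots> = (\<Prod>j\<in>J. emeasure coin ((+) (z j) -` F j))"
      unfolding \<mu>_def using J
      by (intro P.emeasure_PiM_emb) (auto simp: sets_coin sets_borel_bit)
    finally show "emeasure (distr (Pi\<^sub>M UNIV (\<lambda>_. coin)) borel ((\<boxplus>) z)) ?X =
        (\<Prod>j\<in>J. emeasure coin (F j))"
      by (simp add: coin_inv \<mu>_def)
  qed
  moreover have "prob_space \<mu>"
    unfolding \<mu>_def by (rule prob_space_PiM) (rule coin.prob_space_axioms)
  ultimately show "haar_prob \<mu>"
    by (simp add: haar_prob_iff sets_\<mu>)
qed

lemma haar_prob_haar: "haar_prob haar"
  unfolding haar_def using haar_prob_exists haar_prob_unique by (metis theI)

interpretation haar: prob_space haar
  using haar_prob_haar by (simp add: haar_prob_iff)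

lemma sets_haar [measurable_cong, simp]: "sets haar = sets borel"
  using haar_prob_haar by (simp add: haar_prob_iff)

lemma space_haar [simp]: "space haar = UNIV"
  using sets_eq_imp_space_eq[OF sets_haar] by simp

lemma distr_haar_translate: "distr haar borel ((\<boxplus>) z) = haar"
  using haar_prob_haar by (simp add: haar_prob_iff)

lemma integral_haar_translate:
  fixes f :: "cantor \<Rightarrow> complex"
  assumes [measurable]: "f \<in> borel_measurable borel"
  shows "(LINT x|haar. f (z \<boxplus> x)) = (LINT x|haar. f x)"
proof -
  have "(LINT x|haar. f (z \<boxplus> x)) = (LINT x|distr haar borel ((\<boxplus>) z). f x)"
    by (rule integral_distr[symmetric]) measurable
  then show ?thesis
    by (simp add: distr_haar_translate)
qed

text \<open>
  A cylinder fixing \<open>n\<close> coordinates is the union of two cylinders fixing \<open>n + 1\<close> coordinates, and these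
  are translates of each other. So a null cylinder at level \<open>n + 1\<close> would give one at level
  \<open>n\<close>, and finally a null space.
\<close>

lemma emeasure_haar_agree_pos: "emeasure haar {y. \<forall>i<n. y i = x i} > 0"
proof -
  \<comment> \<open>Translation by the difference of \<open>x\<close> and \<open>x'\<close>, which over bits is their sum.\<close>
  have trans: "emeasure haar {y. \<forall>i<n. y i = x i} = emeasure haar {y. \<forall>i<n. y i = x' i}"
    for n x x'
  proof -
    have "emeasure haar {y. \<forall>i<n. y i = x i} =
        emeasure (distr haar borel ((\<boxplus>) (x \<boxplus> x'))) {y. \<forall>i<n. y i = x i}"
      by (simp add: distr_haar_translate)
    also have "\<dots> = emeasure haar ((\<boxplus>) (x \<boxplus> x') -` {y. \<forall>i<n. y i = x i} \<inter> space haar)"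
      by (rule emeasure_distr) (simp_all add: borel_open open_agree)
    also have "(\<boxplus>) (x \<boxplus> x') -` {y. \<forall>i<n. y i = x i} \<inter> space haar = {y. \<forall>i<n. y i = x' i}"
    proof -
      have eq: "a + b + c = a \<longleftrightarrow> c = b" for a b c :: bit
        by (cases a; cases b; cases c) simp_all
      show ?thesis
        by (simp add: cadd_def eq vimage_def)
    qed
    finally show ?thesis .
  qed
  show ?thesis
  proof (induction n arbitrary: x)
    case 0
    then show ?case
      using haar.emeasure_space_1 by simp
  next
    case (Suc n)
    let ?C = "\<lambda>x. {y :: cantor. \<forall>i<Suc n. y i = x i}"
    have "{y. \<forall>i<n. y i = x i} \<subseteq> ?C x \<union> ?C (x(n := x n + 1))"
    proof
      fix y assume "y \<in> {y. \<forall>i<n. y i = x i}"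
      moreover have "y n = x n \<or> y n = x n + 1"
        by (cases "x n"; cases "y n") simp_all
      ultimately show "y \<in> ?C x \<union> ?C (x(n := x n + 1))"
        by (elim disjE) (simp_all add: less_Suc_eq)
    qed
    then have "emeasure haar {y. \<forall>i<n. y i = x i} \<le> emeasure haar (?C x \<union> ?C (x(n := x n + 1)))"
      by (rule emeasure_mono) (simp add: borel_open open_agree sets.Un)
    also have "\<dots> \<le> emeasure haar (?C x) + emeasure haar (?C (x(n := x n + 1)))"
      by (rule emeasure_subadditive) (simp_all add: borel_open open_agree)
    also have "emeasure haar (?C (x(n := x n + 1))) = emeasure haar (?C x)"
      by (rule trans)
    finally have "emeasure haar {y. \<forall>i<n. y i = x i} \<le> emeasure haar (?C x) + emeasure haar (?C x)" .
    then have "emeasure haar (?C x) \<noteq> 0"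
      using Suc.IH[of x] by (metis add_0 leD)
    then show ?case
      using zero_less_iff_neq_zero by blast
  qed
qed

section \<open>The conditional expectations\<close>

lemma measurable_bcontfun [measurable]: "apply_bcontfun f \<in> borel_measurable borel"
  by (intro borel_measurable_continuous_onI continuous_intros)

lemma integrable_haar_bcontfun:
  fixes f :: "cantor \<Rightarrow>\<^sub>C complex"
  assumes "continuous_on UNIV g"
  shows "integrable haar (\<lambda>z. apply_bcontfun f (g z))"
proof (rule haar.integrable_const_bound[where B = "norm f"])
  show "(\<lambda>z. apply_bcontfun f (g z)) \<in> borel_measurable haar"
    using borel_measurable_continuous_onI[OF continuous_on_bcontfun[OF assms, of f]] by simp
qed (simp add: norm_bounded)

text \<open>
  Writing the tail as a summand, instead of splicing \<open>z\<close> onto a prefix of \<open>x\<close>, lets translation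
  invariance of the Haar measure apply to the average directly.
\<close>

definition tail_average :: "nat \<Rightarrow> (cantor \<Rightarrow>\<^sub>C complex) \<Rightarrow> (cantor \<Rightarrow>\<^sub>C complex)"
  where "tail_average n f = Bcontfun (\<lambda>x. LINT z|haar. f (x \<boxplus> tail n z))"

lemma cadd_decompose:
  assumes "\<And>i. i < n \<Longrightarrow> x i = y i"
  shows "y = x \<boxplus> tail n (x \<boxplus> y)"
proof
  fix i
  show "y i = (x \<boxplus> tail n (x \<boxplus> y)) i"
    using assms[of i] by (simp add: cadd_def tail_def bit_add_add_self)
qed

text \<open>
  If \<open>x\<close> and \<open>y\<close> agree below \<open>n\<close>, then \<open>y = x + t\<^sub>n (x + y)\<close>, so passing from \<open>x\<close> to \<open>y\<close> only
  translates the integration variable by \<open>x + y\<close>.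
\<close>

lemma depends_on_first_average:
  fixes f :: "cantor \<Rightarrow>\<^sub>C complex"
  shows "depends_on_first n (\<lambda>x. LINT z|haar. f (x \<boxplus> tail n z))"
  unfolding depends_on_first_def
proof (intro allI impI)
  fix x y :: cantor assume "\<forall>i<n. x i = y i"
  then have y: "y = x \<boxplus> tail n (x \<boxplus> y)"
    by (intro cadd_decompose) auto
  have meas: "(\<lambda>z. f (x \<boxplus> tail n z)) \<in> borel_measurable borel"
    by (intro borel_measurable_continuous_onI continuous_intros)
  have "(LINT z|haar. f (y \<boxplus> tail n z)) = (LINT z|haar. f (x \<boxplus> tail n ((x \<boxplus> y) \<boxplus> z)))"
    by (subst y) (simp add: tail_cadd cadd_assoc)
  also have "\<dots> = (LINT z|haar. f (x \<boxplus> tail n z))"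
    using integral_haar_translate[OF meas, of "x \<boxplus> y"] by simp
  finally show "(LINT z|haar. f (x \<boxplus> tail n z)) = (LINT z|haar. f (y \<boxplus> tail n z))" ..
qed

lemma norm_average_le:
  fixes f :: "cantor \<Rightarrow>\<^sub>C complex"
  shows "norm (LINT z|haar. f (x \<boxplus> tail n z)) \<le> norm f"
proof -
  have "norm (LINT z|haar. f (x \<boxplus> tail n z)) \<le> (LINT z|haar. norm (f (x \<boxplus> tail n z)))"
    by (rule integral_norm_bound)
  also have "\<dots> \<le> (LINT z|haar. norm f)"
    by (rule integral_mono)
      (auto intro!: integrable_norm integrable_haar_bcontfun continuous_intros norm_bounded)
  also have "\<dots> = norm f"
    using haar.prob_space by simp
  finally show ?thesis .
qed

lemma apply_tail_average [simp]:
  "apply_bcontfun (tail_average n f) x = (LINT z|haar. f (x \<boxplus> tail n z))"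
proof -
  have "(\<lambda>x. LINT z|haar. f (x \<boxplus> tail n z)) \<in> bcontfun"
    by (intro bcontfun_normI[where b = "norm f"] norm_average_le
        continuous_on_depends_on_first[OF depends_on_first_average])
  then show ?thesis
    by (simp add: tail_average_def Bcontfun_inverse)
qed

lemma depends_on_first_tail_average: "depends_on_first n (apply_bcontfun (tail_average n f))"
proof -
  have "apply_bcontfun (tail_average n f) = (\<lambda>x. LINT z|haar. f (x \<boxplus> tail n z))"
    by (rule ext) simp
  then show ?thesis
    using depends_on_first_average[of n f] by (simp only:)
qed

lemma tail_average_fixed:
  assumes "depends_on_first n (apply_bcontfun f)"
  shows "tail_average n f = f"
  using haar.prob_space by (intro bcontfun_eqI) (simp add: depends_on_first_tail[OF assms])

text \<open>
  Positive means of the form \<open>g\<^sup>* g\<close>, so a continuous square root is needed. The pointwise root of the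
  average is continuous because it again depends on finitely many coordinates.
\<close>

lemma positive_tail_average:
  assumes "positive_elt f"
  shows "positive_elt (tail_average n f)"
proof -
  obtain g where f: "f = star g * g"
    using assms by (auto simp: positive_elt_def)
  define h where "h x = csqrt (tail_average n f x)" for x
  have fx: "f x = of_real ((cmod (g x))\<^sup>2)" for x
    by (simp add: f complex_norm_square mult.commute del: of_real_power)
  have h_sq: "cnj (h x) * h x = tail_average n f x" for x
  proof -
    define c where "c = (LINT z|haar. (cmod (g (x \<boxplus> tail n z)))\<^sup>2)"
    have "tail_average n f x = of_real c"
      by (simp add: fx c_def del: of_real_power)
    moreover have "c \<ge> 0"
      unfolding c_def by simp
    ultimately show ?thesis
      by (simp add: h_def csqrt_of_real_nonneg flip: of_real_mult)
  qed
  have dep: "depends_on_first n h"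
    using depends_on_first_tail_average[of n f] depends_on_first_tail_average[of n f]
    by (rule depends_on_first_map2) (rule h_def)
  have "h \<in> bcontfun"
  proof (intro bcontfun_normI continuous_on_depends_on_first)
    show "depends_on_first n h" by (rule dep)
    show "norm (h x) \<le> sqrt (norm f)" for x
      using norm_average_le[of f x n] by (simp add: h_def norm_csqrt)
  qed
  then have "star (Bcontfun h) * Bcontfun h = tail_average n f"
    using h_sq by (intro bcontfun_eqI) (simp add: Bcontfun_inverse del: apply_tail_average)
  then show ?thesis
    unfolding positive_elt_def by metis
qed

text \<open>
  After exchanging the integrals, the inner one runs over \<open>x\<close>, and \<open>t\<^sub>n z\<close> is a mere translation.
\<close>

lemma haar_state_tail_average: "haar_state (tail_average n f) = haar_state f"
proof -
  interpret P: pair_sigma_finite haar haar ..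
  have int: "integrable (haar \<Otimes>\<^sub>M haar) (\<lambda>(x, z). f (x \<boxplus> tail n z))"
  proof -
    interpret PP: pair_prob_space haar haar ..
    have "(\<lambda>p. f (fst p \<boxplus> tail n (snd p))) \<in> borel_measurable borel"
      by (intro borel_measurable_continuous_onI continuous_intros)
    then have "(\<lambda>p. f (fst p \<boxplus> tail n (snd p))) \<in> borel_measurable (borel \<Otimes>\<^sub>M borel)"
      by (simp only: borel_prod)
    then have "(\<lambda>p. f (fst p \<boxplus> tail n (snd p))) \<in> borel_measurable (haar \<Otimes>\<^sub>M haar)"
      by (simp cong: measurable_cong_sets sets_pair_measure_cong)
    then show ?thesis
      unfolding case_prod_beta
      by (rule PP.integrable_const_bound[where B = "norm f", rotated]) (simp add: norm_bounded)
  qed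
  have "haar_state (tail_average n f) = (LINT x|haar. LINT z|haar. f (x \<boxplus> tail n z))"
    by (simp add: haar_state_def)
  also have "\<dots> = (LINT z|haar. LINT x|haar. f (x \<boxplus> tail n z))"
    by (rule P.Fubini_integral[symmetric, OF int])
  also have "\<dots> = (LINT z|haar. LINT x|haar. f x)"
    by (subst cadd_commute) (simp add: integral_haar_translate)
  also have "\<dots> = haar_state f"
    using haar.prob_space by (simp add: haar_state_def)
  finally show ?thesis .
qed

section \<open>The algebras of the inductive sequence\<close>

lemma apply_two_bcontfun [simp]: "apply_bcontfun (2 :: 'a::topological_space \<Rightarrow>\<^sub>C complex) x = 2"
proof -
  have "apply_bcontfun (1 + 1 :: 'a \<Rightarrow>\<^sub>C complex) x = 1 + 1"
    by (simp only: plus_bcontfun.rep_eq apply_one_bcontfun)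
  then show ?thesis
    by (simp only: one_add_one)
qed

lemma apply_u_gen: "apply_bcontfun (u_gen k) x = (if x k = 1 then 1 else -1)"
  by (simp add: u_gen_def)

lemma continuous_on_eval: "continuous_on S (\<lambda>f :: cantor \<Rightarrow>\<^sub>C complex. apply_bcontfun f x)"
  by (intro linear_continuous_on bounded_linear_intro[where K = 1]) (simp_all add: norm_bounded)

context
  fixes n :: nat and f g :: "cantor \<Rightarrow>\<^sub>C complex"
  assumes f: "depends_on_first n (apply_bcontfun f)"
begin

lemma depends_on_first_cscale: "depends_on_first n (apply_bcontfun (cscale c f))"
  using f depends_on_first_map2[of n f f "cscale c f" "\<lambda>a _. c * a"] by (simp only: apply_cscale)

lemma depends_on_first_star: "depends_on_first n (apply_bcontfun (star f))"
  using f depends_on_first_map2[of n f f "star f" "\<lambda>a _. cnj a"] by (simp only: apply_star)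

context
  assumes g: "depends_on_first n (apply_bcontfun g)"
begin

lemma depends_on_first_add: "depends_on_first n (apply_bcontfun (f + g))"
  using f g depends_on_first_map2[of n f g "f + g" "(+)"] by (simp only: plus_bcontfun.rep_eq)

lemma depends_on_first_diff: "depends_on_first n (apply_bcontfun (f - g))"
  using f g depends_on_first_map2[of n f g "f - g" "(-)"] by (simp only: minus_bcontfun.rep_eq)

lemma depends_on_first_mult: "depends_on_first n (apply_bcontfun (f * g))"
  using f g depends_on_first_map2[of n f g "f * g" "(*)"] by (simp only: apply_times_bcontfun)

end

end

lemma cstar_subalgebra_depends_on_first:
  "cstar_subalgebra {f. depends_on_first n (apply_bcontfun f)}"
proof -
  let ?D = "{f :: cantor \<Rightarrow>\<^sub>C complex. depends_on_first n (apply_bcontfun f)}"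
  have "closed {f :: cantor \<Rightarrow>\<^sub>C complex. apply_bcontfun f x = apply_bcontfun f y}" for x y
    by (intro closed_Collect_eq continuous_on_eval)
  then have "closed (\<Inter>x. \<Inter>y\<in>{y. \<forall>i<n. x i = y i}.
      {f :: cantor \<Rightarrow>\<^sub>C complex. apply_bcontfun f x = apply_bcontfun f y})"
    by (intro closed_INT ballI)
  also have "(\<Inter>x. \<Inter>y\<in>{y. \<forall>i<n. x i = y i}.
      {f :: cantor \<Rightarrow>\<^sub>C complex. apply_bcontfun f x = apply_bcontfun f y}) = ?D"
    unfolding depends_on_first_def by blast
  finally have "closed ?D" .
  moreover have "0 \<in> ?D"
    by (simp add: depends_on_firstI)
  ultimately show ?thesis
    unfolding cstar_subalgebra_def mem_Collect_eq Ball_def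
    by (intro conjI allI impI depends_on_first_add depends_on_first_mult depends_on_first_cscale
        depends_on_first_star) assumption+
qed

text \<open>
  Induction on the number of coordinates: with \<open>p = (1 + u\<^sub>k) / 2\<close> the indicator of
  \<open>x\<^sub>k = 1\<close>, a function \<open>f\<close> of the first \<open>k + 1\<close> coordinates equals \<open>p g\<^sub>1 + (1 - p) g\<^sub>0\<close>, where
  \<open>g\<^sub>b\<close> is \<open>f\<close> with coordinate \<open>k\<close> replaced by \<open>b\<close> and so depends on the first \<open>k\<close> coordinates only.
\<close>

lemma depends_on_first_in_subalgebra:
  assumes B: "cstar_subalgebra B" "1 \<in> B" "\<And>k. k < n \<Longrightarrow> u_gen k \<in> B"
  shows "k \<le> n \<Longrightarrow> depends_on_first k (apply_bcontfun f) \<Longrightarrow> f \<in> B"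
proof (induction k arbitrary: f)
  case 0
  then obtain c where "apply_bcontfun f = (\<lambda>_. c)"
    by (auto simp: depends_on_first_zero)
  then have "f = cscale c 1"
    by (intro bcontfun_eqI) simp
  then show ?case
    using B by (simp add: cstar_subalgebra_def)
next
  case (Suc k)
  define g where "g b = Bcontfun (\<lambda>x :: cantor. f (x(k := b)))" for b
  have cont: "continuous_on UNIV (\<lambda>x :: cantor. x(k := b))" for b
  proof -
    have "continuous_on UNIV (\<lambda>x :: cantor. (x(k := b)) i)" for i
      by (cases "i = k") simp_all
    then show ?thesis
      by (rule continuous_on_coordinatewise_then_product)
  qed
  have g: "apply_bcontfun (g b) x = f (x(k := b))" for b x
  proof -
    have "(\<lambda>x :: cantor. f (x(k := b))) \<in> bcontfun"
      by (intro bcontfun_normI[where b = "norm f"] norm_bounded continuous_intros cont)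
    then show ?thesis
      by (simp add: g_def Bcontfun_inverse)
  qed
  have gB: "g b \<in> B" for b
  proof (rule Suc.IH)
    show "depends_on_first k (apply_bcontfun (g b))"
      by (rule depends_on_firstI, unfold g, rule depends_on_firstD[OF Suc.prems(2)])
        (auto simp: less_Suc_eq)
  qed (use Suc.prems in simp)
  have "f = cscale (1/2) (1 + u_gen k) * g 1 + cscale (1/2) (1 + cscale (-1) (u_gen k)) * g 0"
  proof (rule bcontfun_eqI)
    fix x :: cantor
    show "f x = apply_bcontfun (cscale (1/2) (1 + u_gen k) * g 1 +
        cscale (1/2) (1 + cscale (-1) (u_gen k)) * g 0) x"
      by (cases "x k") (simp_all add: g apply_u_gen fun_upd_idem)
  qed
  moreover have "u_gen k \<in> B"
    using B Suc.prems by simp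
  ultimately show ?case
    using B gB by (simp add: cstar_subalgebra_def)
qed

lemma A_alg_eq: "A_alg n = {f. depends_on_first n (apply_bcontfun f)}"
proof (cases "n = 0")
  case True
  have "f \<in> range (\<lambda>c. cscale c 1)" if f: "apply_bcontfun f = (\<lambda>_ :: cantor. c)" for f c
  proof
    show "f = cscale c 1"
      by (rule bcontfun_eqI) (simp add: f)
  qed simp
  moreover have "depends_on_first 0 (apply_bcontfun (cscale c 1 :: cantor \<Rightarrow>\<^sub>C complex))" for c
    by (simp add: depends_on_firstI)
  ultimately show ?thesis
    using True by (auto simp: A_alg_def depends_on_first_zero)
next
  case False
  have "insert 1 (u_gen ` {..<n}) \<subseteq> {f. depends_on_first n (apply_bcontfun f)}"
    by (auto simp: depends_on_first_def apply_u_gen)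
  moreover have "f \<in> B" if "depends_on_first n (apply_bcontfun f)" "cstar_subalgebra B"
    "insert 1 (u_gen ` {..<n}) \<subseteq> B" for f B
    by (rule depends_on_first_in_subalgebra[of B n n]) (use that in auto)
  ultimately show ?thesis
    using False cstar_subalgebra_depends_on_first[of n]
    by (auto simp: A_alg_def cstar_generated_def)
qed

lemma cond_expectation_tail_average: "cond_expectation (A_alg n) (tail_average n)"
  unfolding cond_expectation_def
proof (intro conjI allI impI ballI)
  fix f g :: "cantor \<Rightarrow>\<^sub>C complex" and c
  have int: "integrable haar (\<lambda>z. f (x \<boxplus> tail n z))" for f :: "cantor \<Rightarrow>\<^sub>C complex" and x
    by (intro integrable_haar_bcontfun continuous_intros)
  show "tail_average n (f + g) = tail_average n f + tail_average n g"
    by (rule bcontfun_eqI) (simp add: int)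
  show "tail_average n (cscale c f) = cscale c (tail_average n f)"
    by (rule bcontfun_eqI) simp
  show "positive_elt f \<Longrightarrow> positive_elt (tail_average n f)"
    by (rule positive_tail_average)
  show "norm (tail_average n f) \<le> norm f"
    by (rule norm_bound) (simp add: norm_average_le)
next
  fix a b f assume "a \<in> A_alg n" "b \<in> A_alg n"
  then show "tail_average n (a * f * b) = a * tail_average n f * b"
    by (intro bcontfun_eqI) (simp add: A_alg_eq depends_on_first_tail)
next
  show *: "tail_average n b = b" if "b \<in> A_alg n" for b
    using that by (simp add: A_alg_eq tail_average_fixed)
  show "range (tail_average n) = A_alg n"
  proof
    show "range (tail_average n) \<subseteq> A_alg n"
      using depends_on_first_tail_average by (auto simp: A_alg_eq)
    show "A_alg n \<subseteq> range (tail_average n)"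
      using * by (metis rangeI subsetI)
  qed
qed

text \<open>
  If \<open>\<bar>g\<bar>\<^sup>2\<close> integrates to zero, then \<open>g\<close> vanishes almost everywhere, hence somewhere on each cylinder,
  as these have positive measure; and \<open>g\<close> is constant on the cylinders of level \<open>n\<close>.
\<close>

lemma haar_state_faithful:
  assumes g: "depends_on_first n (apply_bcontfun g)" and 0: "haar_state (star g * g) = 0"
  shows "g = 0"
proof (rule bcontfun_eqI)
  fix x
  have int: "integrable haar (\<lambda>z. (cmod (g z))\<^sup>2)"
    by (rule haar.integrable_const_bound[where B = "(norm g)\<^sup>2"])
      (auto intro!: power_mono norm_bounded)
  have "haar_state (star g * g) = (LINT z|haar. of_real ((cmod (g z))\<^sup>2))"
    by (simp add: haar_state_def complex_norm_square mult.commute del: of_real_power)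
  then have "(LINT z|haar. (cmod (g z))\<^sup>2) = 0"
    using 0 by (simp del: of_real_power)
  then have "AE z in haar. (cmod (g z))\<^sup>2 = 0"
    using integral_nonneg_eq_0_iff_AE[OF int] by simp
  then have ae: "AE z in haar. g z = 0"
    by simp
  show "apply_bcontfun g x = apply_bcontfun 0 x"
  proof (rule ccontr)
    assume "apply_bcontfun g x \<noteq> apply_bcontfun 0 x"
    then have "g z \<noteq> 0" if "\<forall>i<n. z i = x i" for z
      using depends_on_firstD[OF g, of z x] that by auto
    then have "AE z in haar. z \<notin> {y. \<forall>i<n. y i = x i}"
      using ae by (auto elim!: eventually_mono)
    then have "emeasure haar {y. \<forall>i<n. y i = x i} = 0"
      by (subst (asm) AE_iff_measurable[OF _ refl]) (auto intro!: borel_open open_agree)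
    then show False
      using emeasure_haar_agree_pos[of n x] by simp
  qed
qed

lemma cond_expectation_bimodule:
  assumes "cond_expectation B E" "a \<in> B" "b \<in> B"
  shows "E (a * f * b) = a * E f * b"
proof -
  have "\<forall>a\<in>B. \<forall>b\<in>B. \<forall>f. E (a * f * b) = a * E f * b"
    using assms(1) unfolding cond_expectation_def by (elim conjE)
  then show ?thesis
    using assms(2,3) by blast
qed

text \<open>
  For two trace-preserving expectations \<open>F\<close> and \<open>E\<close> and \<open>a \<in> A\<^sub>n\<close>, the module property gives
  \<open>\<lambda>(a F f) = \<lambda>(F (a f)) = \<lambda>(a f) = \<lambda>(a E f)\<close>. With \<open>g = F f - E f\<close> and \<open>a = g\<^sup>*\<close> this reads \<open>\<lambda>(g\<^sup>* g) = 0\<close>.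
\<close>

lemma E_exp_eq: "E_exp n = tail_average n"
  unfolding E_exp_def
proof (rule the_equality)
  show "cond_expectation (A_alg n) (tail_average n) \<and> haar_state \<circ> tail_average n = haar_state"
    by (auto simp: cond_expectation_tail_average haar_state_tail_average)
next
  fix F assume F: "cond_expectation (A_alg n) F \<and> haar_state \<circ> F = haar_state"
  have one: "1 \<in> A_alg n"
    by (simp add: A_alg_eq depends_on_first_def)
  show "F = tail_average n"
  proof
    fix f
    define g where "g = F f - tail_average n f"
    have FA: "F f \<in> A_alg n"
      using F by (auto simp: cond_expectation_def)
    have EA: "tail_average n f \<in> A_alg n"
      by (simp add: A_alg_eq depends_on_first_tail_average del: apply_tail_average)
    have gA: "g \<in> A_alg n"
      using FA EA unfolding A_alg_eq g_def mem_Collect_eq by (rule depends_on_first_diff)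
    then have sA: "star g \<in> A_alg n"
      unfolding A_alg_eq mem_Collect_eq by (rule depends_on_first_star)
    have *: "haar_state (star g * G f) = haar_state (star g * f)"
      if G: "cond_expectation (A_alg n) G" "haar_state \<circ> G = haar_state" for G
    proof -
      have "G (star g * f * 1) = star g * G f * 1"
        by (rule cond_expectation_bimodule[OF G(1) sA one])
      then show ?thesis
        using fun_cong[OF G(2), of "star g * f"] by simp
    qed
    have int: "integrable haar (apply_bcontfun h)" for h :: "cantor \<Rightarrow>\<^sub>C complex"
      using integrable_haar_bcontfun[OF continuous_on_id, of h] by simp
    have "haar_state (star g * g) = haar_state (star g * F f - star g * tail_average n f)"
      by (simp add: g_def right_diff_distrib)
    also have "\<dots> = haar_state (star g * F f) - haar_state (star g * tail_average n f)"
      using Bochner_Integration.integral_diff[OF int[of "star g * F f"]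
          int[of "star g * tail_average n f"]]
      by (simp add: haar_state_def del: apply_tail_average apply_times_bcontfun)
    also have "\<dots> = 0"
    proof -
      have "haar_state \<circ> tail_average n = haar_state"
        by (rule ext) (simp add: haar_state_tail_average)
      then show ?thesis
        using *[of F] *[of "tail_average n"] F cond_expectation_tail_average[of n] by simp
    qed
    finally have "g = 0"
      using gA by (intro haar_state_faithful[of n]) (auto simp: A_alg_eq)
    then show "F f = tail_average n f"
      by (simp add: g_def)
  qed
qed

section \<open>The distance\<close>

text \<open>
  Flipping coordinate \<open>k\<close> of the integration variable preserves the Haar measure and, as \<open>n \<le> k\<close>, reaches
  the argument of \<open>u\<^sub>k\<close> and reverses its sign. So the average equals its own negative.
\<close>

lemma tail_average_u_gen:
  assumes "n \<le> k"
  shows "tail_average n (u_gen k) = 0"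
proof (rule bcontfun_eqI)
  fix x
  define e :: cantor where "e = (\<lambda>i. if i = k then 1 else 0)"
  let ?h = "\<lambda>z. u_gen k (x \<boxplus> tail n z)"
  have meas: "?h \<in> borel_measurable borel"
    by (intro borel_measurable_continuous_onI continuous_intros)
  have "?h (e \<boxplus> z) = - ?h z" for z
  proof -
    have "a + (1 + b) = 1 \<longleftrightarrow> a + b \<noteq> 1" for a b :: bit
      by (cases a; cases b) simp_all
    then show ?thesis
      using assms by (simp add: apply_u_gen cadd_def tail_def e_def)
  qed
  then have "(LINT z|haar. ?h z) = - (LINT z|haar. ?h z)"
    using integral_haar_translate[OF meas, of e] by simp
  then show "tail_average n (u_gen k) x = apply_bcontfun 0 x"
    by simp
qed

lemma beta_geom_pos: "r > 1 \<Longrightarrow> beta_geom r n > 0"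
  by (simp add: beta_geom_def)

lemma lip_norm_le_1_iff:
  assumes "\<And>n. \<beta> n > 0"
  shows "lip_norm \<beta> f \<le> 1 \<longleftrightarrow> (\<forall>n. norm (f - tail_average n f) \<le> \<beta> n)"
proof -
  have "ennreal (norm (f - tail_average n f) / \<beta> n) \<le> 1 \<longleftrightarrow> norm (f - tail_average n f) \<le> \<beta> n" for n
    using assms[of n] by (subst ennreal_le_1) (simp add: divide_le_eq)
  then show ?thesis
    by (simp add: lip_norm_def E_exp_eq SUP_le_iff)
qed

theorem corollary7p6:
  fixes r :: real and x y :: cantor
  assumes "r > 1"
  shows "mk (lip_norm (beta_geom r)) (eval_state x) (eval_state y) =
    (if x = y then 0 else ennreal (r powr (- real (LEAST n. x n \<noteq> y n))))"
proof (cases "x = y")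
  case True
  have "mk (lip_norm (beta_geom r)) (eval_state x) (eval_state x) \<le> 0"
    unfolding mk_def by (rule SUP_least) simp
  then show ?thesis
    using True by simp
next
  case False
  define N where "N = (LEAST n. x n \<noteq> y n)"
  have "\<exists>n. x n \<noteq> y n"
    using False by (meson ext)
  then have N: "x N \<noteq> y N"
    unfolding N_def by (rule LeastI_ex)
  have agree: "x i = y i" if "i < N" for i
    using that not_less_Least[of i "\<lambda>n. x n \<noteq> y n"] unfolding N_def by blast
  note L = lip_norm_le_1_iff[of "beta_geom r", OF beta_geom_pos[OF assms]]
  have two_beta: "2 * beta_geom r N = r powr (- real N)"
    by (simp add: beta_geom_def)
  have "mk (lip_norm (beta_geom r)) (eval_state x) (eval_state y) = ennreal (r powr (- real N))"
  proof (rule antisym)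
    show "mk (lip_norm (beta_geom r)) (eval_state x) (eval_state y) \<le> ennreal (r powr (- real N))"
      unfolding mk_def
    proof (rule SUP_least)
      fix f assume f: "f \<in> {f. self_adjoint f \<and> lip_norm (beta_geom r) f \<le> 1}"
      let ?g = "f - tail_average N f"
      \<comment> \<open>Insert the averages at level \<open>N\<close>, where \<open>x\<close> and \<open>y\<close> cannot yet be told apart.\<close>
      have "tail_average N f x = tail_average N f y"
        using depends_on_first_tail_average agree by (rule depends_on_firstD)
      then have "f x - f y = ?g x - ?g y"
        by (simp del: apply_tail_average)
      also have "norm \<dots> \<le> norm ?g + norm ?g"
        by (rule order_trans[OF norm_triangle_ineq4]) (intro add_mono norm_bounded)
      also have "\<dots> \<le> r powr (- real N)"
        using f L[of f] two_beta by (smt (verit) mem_Collect_eq)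
      finally show "ennreal (cmod (eval_state x f - eval_state y f)) \<le> ennreal (r powr (- real N))"
        by (simp add: eval_state_def ennreal_leI)
    qed
  next
    \<comment> \<open>The extremal function: the largest multiple of \<open>u\<^sub>N\<close> of Lip-norm at most 1.\<close>
    define f where "f = cscale (of_real (beta_geom r N)) (u_gen N)"
    have avg: "tail_average n f = (if n \<le> N then 0 else f)" for n
    proof (cases "n \<le> N")
      case True
      have "tail_average n f = cscale (of_real (beta_geom r N)) (tail_average n (u_gen N))"
        using cond_expectation_tail_average[of n] by (simp add: cond_expectation_def f_def)
      then show ?thesis
        using True by (simp add: tail_average_u_gen cscale_def)
    next
      case False
      have "depends_on_first n (apply_bcontfun f)"
        using False by (auto simp: depends_on_first_def f_def apply_u_gen)
      then show ?thesis
        using False by (simp add: tail_average_fixed)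
    qed
    have norm_f: "norm f \<le> beta_geom r N"
      by (rule norm_bound) (use beta_geom_pos[OF assms, of N] in \<open>simp add: f_def apply_u_gen norm_mult\<close>)
    have "norm (f - tail_average n f) \<le> beta_geom r n" for n
    proof (cases "n \<le> N")
      case True
      have "beta_geom r N \<le> beta_geom r n"
        using True assms by (simp add: beta_geom_def)
      then show ?thesis
        using True norm_f by (simp add: avg)
    next
      case False
      then show ?thesis
        using beta_geom_pos[OF assms, of n] by (simp add: avg less_imp_le)
    qed
    then have "lip_norm (beta_geom r) f \<le> 1"
      by (simp add: L)
    moreover have "self_adjoint f"
      unfolding self_adjoint_def by (rule bcontfun_eqI) (simp add: f_def apply_u_gen)
    ultimately have "ennreal (cmod (eval_state x f - eval_state y f))
        \<le> mk (lip_norm (beta_geom r)) (eval_state x) (eval_state y)"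
      unfolding mk_def by (intro SUP_upper) simp
    moreover have "cmod (eval_state x f - eval_state y f) = r powr (- real N)"
    proof -
      have "(x N = 1) \<noteq> (y N = 1)"
        using N by (cases "x N"; cases "y N") simp_all
      then have "eval_state x f - eval_state y f = of_real (2 * beta_geom r N) \<or>
          eval_state x f - eval_state y f = of_real (- (2 * beta_geom r N))"
        by (auto simp: eval_state_def f_def apply_u_gen)
      then show ?thesis
        using two_beta by (metis abs_minus_cancel norm_of_real powr_ge_zero abs_of_nonneg)
    qed
    ultimately show "ennreal (r powr (- real N)) \<le> mk (lip_norm (beta_geom r)) (eval_state x) (eval_state y)"
      by simp
  qed
  then show ?thesis
    using False by (simp add: N_def)
qed

end
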